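(* For every integer $m\ge 2$, the rows of the $(m-1)$-Catalan triangle are log-concave; that is, for every $n\geq 1$ and every $k\ge 1$, $$\bigl(C^{(m-1)}_{n,k}\bigr)^2\ \ge\ C^{(m-1)}_{n,k-1}\,C^{(m-1)}_{n,k+1}.$$
   Context: For $s\ge1$ the $s$-binomial coefficients $\binom{n}{d}_s$ are defined by $(1+x+\cdots+x^s)^n=\sum_{d\in\mathbb{Z}}\binom{n}{d}_s x^d$. The $s$-Catalan triangle has as entry in row $n$ and column $k$, for $n>0$ and $k\ge 0$, the number $$C^{(s)}_{n,k}=\binom{2n}{sn+k}_s-\binom{2n}{sn+k+1}_s ,$$ with $C^{(s)}_{0,0}=1$ (row $0$ consists of this single entry). *)

theory Defs
  imports "HOL-Computational_Algebra.Polynomial"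
begin

text \<open>
  The lower index ranges over all integers; the coefficient of a negative power is 0.
\<close>

definition s_binomial :: "nat \<Rightarrow> nat \<Rightarrow> int \<Rightarrow> int" where
  "s_binomial s n d =
     (if d < 0 then 0 else coeff ((\<Sum>i\<le>s. monom 1 i) ^ n) (nat d))"

definition s_catalan :: "nat \<Rightarrow> nat \<Rightarrow> nat \<Rightarrow> int" where
  "s_catalan s n k =
     s_binomial s (2 * n) (int (s * n + k)) - s_binomial s (2 * n) (int (s * n + k + 1))"

text \<open>
  Row 0 needs no separate clause: the formula yields the single nonzero entry 1.
\<close>

lemma s_catalan_row_0: "s_catalan s 0 k = (if k = 0 then 1 else 0)"
  by (simp add: s_catalan_def s_binomial_def nat_add_distrib)

end

theory Submission
  imports Defs
begin

text \<open>
  The difference between the \<open>s\<close>-binomial coefficients of row \<open>N\<close> at \<open>d\<close> and \<open>d - 1\<close>, for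
  \<open>2 d \<le> s N\<close>, is the multiplicity of the irreducible \<open>SL\<^sub>2\<close>-module of highest weight
  \<open>s N - 2 d\<close> in the \<open>N\<close>-th tensor power of the one of highest weight \<open>s\<close>. By the
  Clebsch-Gordan rule, tensoring once more replaces these multiplicities by sums over windows
  of consecutive indices. As the index grows, such a window is first translated and then shrinks
  at both ends, and in both regimes log-concavity of the summands passes to the sums.
\<close>

section \<open>Log-concave sequences without internal zeros\<close>

text \<open>The third clause makes the support an initial segment of the nonnegative integers. It
  excludes sequences such as 1, 0, 0, 1, which satisfy the square inequality but violate
  \<open>log_concave_seq_outer_le_inner\<close>.\<close>

definition log_concave_seq :: "(int \<Rightarrow> int) \<Rightarrow> bool" where
  "log_concave_seq f \<longleftrightarrow>
     (\<forall>i. 0 \<le> f i) \<and> (\<forall>i<0. f i = 0) \<and> (\<forall>i\<ge>0. 0 < f (i + 1) \<longrightarrow> 0 < f i) \<and>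
     (\<forall>i. f (i - 1) * f (i + 1) \<le> (f i)\<^sup>2)"

lemma
  assumes "log_concave_seq f"
  shows log_concave_seq_nonneg: "0 \<le> f i"
    and log_concave_seq_eq_0: "i < 0 \<Longrightarrow> f i = 0"
    and log_concave_seq_pos_pred: "0 \<le> i \<Longrightarrow> 0 < f (i + 1) \<Longrightarrow> 0 < f i"
    and log_concave_seq_square: "f (i - 1) * f (i + 1) \<le> (f i)\<^sup>2"
  using assms unfolding log_concave_seq_def by iprover+

lemma log_concave_seq_pos_le:
  assumes "log_concave_seq f" "0 < f j" "0 \<le> i" "i \<le> j"
  shows "0 < f i"
  using \<open>i \<le> j\<close> \<open>0 < f j\<close>
proof (induction j rule: int_ge_induct)
  case (step j)
  then show ?case
    using log_concave_seq_pos_pred[OF assms(1), of j] \<open>0 \<le> i\<close> by simp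
qed

text \<open>Multiply the bound for \<open>j\<close> by log-concavity at \<open>j + 1\<close> and
  cancel \<open>f j * f (j + 1)\<close>. This factor is positive when both outer values are, since
  the support has no gaps; otherwise the left side is 0.\<close>

lemma log_concave_seq_outer_le_inner:
  assumes lc: "log_concave_seq f" and "i \<le> j"
  shows "f (i - 1) * f (j + 1) \<le> f i * f j"
  using \<open>i \<le> j\<close>
proof (induction j rule: int_ge_induct)
  case base
  then show ?case using log_concave_seq_square[OF lc, of i] by (simp add: power2_eq_square)
next
  case (step j)
  have nonneg: "0 \<le> f x" for x using lc by (rule log_concave_seq_nonneg)
  show ?case
  proof (cases "0 < f (i - 1) \<and> 0 < f (j + 2)")
    case True
    then have "0 \<le> i - 1"
      using log_concave_seq_eq_0[OF lc, of "i - 1"] by linarith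
    then have pos: "0 < f j" "0 < f (j + 1)"
      using log_concave_seq_pos_le[OF lc, of "j + 2"] True step.hyps by simp_all
    have "f j * f (j + 2) \<le> f (j + 1) * f (j + 1)"
      using log_concave_seq_square[OF lc, of "j + 1"]
      by (simp add: power2_eq_square algebra_simps)
    then have "(f (i - 1) * f (j + 1)) * (f j * f (j + 2))
        \<le> (f i * f j) * (f (j + 1) * f (j + 1))"
      by (intro mult_mono[OF step.IH] mult_nonneg_nonneg nonneg)
    then have "(f j * f (j + 1)) * (f (i - 1) * f (j + 2))
        \<le> (f j * f (j + 1)) * (f i * f (j + 1))"
      by (simp only: mult_ac)
    moreover have "0 < f j * f (j + 1)"
      using pos by simp
    ultimately have "f (i - 1) * f (j + 2) \<le> f i * f (j + 1)"
      by (rule mult_left_le_imp_le)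
    then show ?thesis by (simp add: add.assoc)
  next
    case False
    then have "f (i - 1) * f (j + 2) = 0"
      using nonneg by (metis less_le mult_eq_0_iff)
    moreover have "0 \<le> f i * f (j + 1)"
      by (intro mult_nonneg_nonneg nonneg)
    ultimately show ?thesis by (simp only: add.assoc one_add_one)
  qed
qed

section \<open>Window sums of a log-concave sequence\<close>

lemma sum_int_first:
  fixes f :: "int \<Rightarrow> int"
  assumes "l \<le> r"
  shows "sum f {l..r} = f l + sum f {l + 1..r}"
proof -
  have "sum f {l..r} = sum f (insert l {l + 1..r})"
    using assms by (intro arg_cong[of _ _ "sum f"]) auto
  also have "\<dots> = f l + sum f {l + 1..r}"
    by (rule sum.insert) auto
  finally show ?thesis .
qed

lemma sum_int_last:
  fixes f :: "int \<Rightarrow> int"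
  assumes "l \<le> r + 1"
  shows "sum f {l..r + 1} = sum f {l..r} + f (r + 1)"
proof -
  have "sum f {l..r + 1} = sum f (insert (r + 1) {l..r})"
    using assms by (intro arg_cong[of _ _ "sum f"]) auto
  also have "\<dots> = f (r + 1) + sum f {l..r}"
    by (rule sum.insert) auto
  finally show ?thesis by (simp only: add.commute)
qed

text \<open>Shift the index by one and compare termwise:
  \<open>f (l - 1) * f (i + 1) \<le> f l * f i\<close>. This controls the change of a window sum at
  its left end.\<close>

lemma window_left_end_le:
  assumes lc: "log_concave_seq f" and "l \<le> r"
  shows "f (l - 1) * (sum f {l..r} - f l) \<le> f l * (sum f {l..r} - f r)"
proof -
  have "f (l - 1) * (sum f {l..r} - f l) = (\<Sum>i\<in>{l + 1..r}. f (l - 1) * f i)"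
    using \<open>l \<le> r\<close> by (simp add: sum_int_first sum_distrib_left)
  also have "\<dots> = (\<Sum>i\<in>{l..r - 1}. f (l - 1) * f (i + 1))"
    by (rule sum.reindex_bij_witness[of _ "\<lambda>i. i + 1" "\<lambda>i. i - 1"]) auto
  also have "\<dots> \<le> (\<Sum>i\<in>{l..r - 1}. f l * f i)"
    by (intro sum_mono log_concave_seq_outer_le_inner[OF lc]) auto
  also have "\<dots> = f l * (sum f {l..r} - f r)"
    using sum_int_last[of l "r - 1" f] \<open>l \<le> r\<close> by (simp add: sum_distrib_left)
  finally show ?thesis .
qed

lemma window_right_end_le:
  assumes lc: "log_concave_seq f" and "l \<le> r"
  shows "f (r + 1) * (sum f {l..r} - f r) \<le> f r * (sum f {l..r} - f l)"
proof -
  have "f (r + 1) * (sum f {l..r} - f r) = (\<Sum>i\<in>{l..r - 1}. f i * f (r + 1))"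
    using sum_int_last[of l "r - 1" f] \<open>l \<le> r\<close> by (simp add: sum_distrib_left mult.commute)
  also have "\<dots> = (\<Sum>i\<in>{l + 1..r}. f (i - 1) * f (r + 1))"
    by (rule sum.reindex_bij_witness[of _ "\<lambda>i. i - 1" "\<lambda>i. i + 1"]) auto
  also have "\<dots> \<le> (\<Sum>i\<in>{l + 1..r}. f i * f r)"
    by (intro sum_mono log_concave_seq_outer_le_inner[OF lc]) auto
  also have "\<dots> = f r * (sum f {l..r} - f l)"
    using \<open>l \<le> r\<close> by (simp add: sum_int_first sum_distrib_left mult.commute)
  finally show ?thesis .
qed

text \<open>Adding the two end inequalities bounds left side minus right side by
  \<open>f (l - 1) * f (r + 1) - f l * f r\<close>, which is at most 0.\<close>

lemma window_translate:
  assumes lc: "log_concave_seq f" and "l \<le> r"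
  shows "sum f {l - 1..r - 1} * sum f {l + 1..r + 1} \<le> (sum f {l..r})\<^sup>2"
proof -
  let ?G = "sum f {l..r}"
  have low: "sum f {l - 1..r - 1} = ?G + f (l - 1) - f r"
    using sum_int_first[of "l - 1" r f] sum_int_last[of "l - 1" "r - 1" f] \<open>l \<le> r\<close> by simp
  have high: "sum f {l + 1..r + 1} = ?G - f l + f (r + 1)"
    using sum_int_first[of l r f] sum_int_last[of "l + 1" r f] \<open>l \<le> r\<close> by simp
  show ?thesis
    using window_left_end_le[OF assms] window_right_end_le[OF assms]
      log_concave_seq_outer_le_inner[OF assms]
    unfolding low high by (simp add: algebra_simps power2_eq_square)
qed

text \<open>Here the end inequalities leave
  \<open>- 2 * f l * f r - f (l - 1) * f r - f (r + 1) * f l\<close>, which is at most 0 by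
  nonnegativity. With \<open>l < r\<close> the two removed end points are distinct.\<close>

lemma window_shrink:
  assumes lc: "log_concave_seq f" and "l < r"
  shows "sum f {l - 1..r + 1} * sum f {l + 1..r - 1} \<le> (sum f {l..r})\<^sup>2"
proof -
  let ?G = "sum f {l..r}"
  have outer: "sum f {l - 1..r + 1} = ?G + f (l - 1) + f (r + 1)"
    using sum_int_first[of "l - 1" "r + 1" f] sum_int_last[of l r f] \<open>l < r\<close> by simp
  have inner: "sum f {l + 1..r - 1} = ?G - f l - f r"
    using sum_int_first[of l r f] sum_int_last[of "l + 1" "r - 1" f] \<open>l < r\<close> by simp
  have "0 \<le> f x" for x using lc by (rule log_concave_seq_nonneg)
  then have "0 \<le> f l * f r" "0 \<le> f (l - 1) * f r" "0 \<le> f (r + 1) * f l" by simp_all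
  then show ?thesis
    using window_left_end_le[OF lc less_imp_le[OF \<open>l < r\<close>]]
      window_right_end_le[OF lc less_imp_le[OF \<open>l < r\<close>]]
    unfolding outer inner by (simp add: algebra_simps power2_eq_square)
qed

text \<open>The induction step for tensor powers, with \<open>M\<close> standing for
  \<open>s * N\<close>. The window translates while \<open>2 * d \<le> M\<close> and shrinks
  afterwards.\<close>

lemma log_concave_seq_window_sum:
  fixes M s :: int
  assumes lc: "log_concave_seq f" and "0 \<le> s"
  defines "g \<equiv> \<lambda>d. if 2 * d \<le> M + s then sum f {d - s..min d (M - d)} else 0"
  shows "log_concave_seq g"
proof -
  have nonneg: "0 \<le> f x" for x using lc by (rule log_concave_seq_nonneg)
  have sum_nonneg_f: "0 \<le> sum f A" for A using nonneg by (simp add: sum_nonneg)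
  have g_nonneg: "0 \<le> g d" for d by (simp add: g_def sum_nonneg_f)
  have "g d = 0" if "d < 0" for d
    using that log_concave_seq_eq_0[OF lc] by (auto simp: g_def intro!: sum.neutral)
  moreover have "0 < g d" if "0 \<le> d" and pos: "0 < g (d + 1)" for d
  proof -
    have le: "2 * (d + 1) \<le> M + s" using pos by (auto simp: g_def split: if_splits)
    then have "sum f {d + 1 - s..min (d + 1) (M - (d + 1))} \<noteq> 0"
      using pos by (simp add: g_def)
    then obtain i where i: "d + 1 - s \<le> i" "i \<le> d + 1" "i \<le> M - (d + 1)" "f i \<noteq> 0"
      by (auto elim!: sum.not_neutral_contains_not_neutral)
    have "0 \<le> i" using i(4) log_concave_seq_eq_0[OF lc] by (meson not_le)
    \<comment> \<open>The predecessor of \<open>i\<close> lies in the window of \<open>d\<close>;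
      the maximum covers \<open>i = 0\<close>.\<close>
    define j where "j = max 0 (i - 1)"
    have "0 < f i" using i(4) nonneg[of i] by simp
    then have "0 < f j"
      using log_concave_seq_pos_le[OF lc, of i j] \<open>0 \<le> i\<close> by (simp add: j_def)
    moreover have "j \<in> {d - s..min d (M - d)}"
      using i \<open>0 \<le> d\<close> \<open>0 \<le> i\<close> by (auto simp: j_def)
    ultimately have "0 < sum f {d - s..min d (M - d)}"
      using nonneg by (intro sum_pos2[of _ j]) auto
    then show ?thesis using le by (simp add: g_def)
  qed
  moreover have "g (d - 1) * g (d + 1) \<le> (g d)\<^sup>2" for d
  proof (cases "2 * (d + 1) \<le> M + s")
    case False
    then show ?thesis by (simp add: g_def)
  next
    case le: True
    let ?l = "d - s"
    have mono: "sum f {a..b} \<le> sum f {a..b'}" if "b \<le> b'" for a b b'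
      using that nonneg by (intro sum_mono2) auto
    have g0: "g (d - 1) = sum f {?l - 1..min (d - 1) (M - d + 1)}"
      and g1: "g d = sum f {?l..min d (M - d)}"
      and g2: "g (d + 1) = sum f {?l + 1..min (d + 1) (M - d - 1)}"
      using le by (simp_all add: g_def algebra_simps)
    show ?thesis
    proof (cases "2 * d \<le> M")
      case True
      \<comment> \<open>At the change of regime a neighbouring window may be smaller than the
        translated one; enlarging it only increases the product.\<close>
      have "g (d - 1) * g (d + 1) \<le> sum f {?l - 1..d - 1} * sum f {?l + 1..d + 1}"
        unfolding g0 g2 by (intro mult_mono mono sum_nonneg_f) auto
      also have "\<dots> \<le> (sum f {?l..d})\<^sup>2"
        using \<open>0 \<le> s\<close> by (intro window_translate[OF lc]) simp
      finally show ?thesis using True by (simp add: g1 min_absorb1)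
    next
      case False
      let ?r = "M - d"
      have "g (d - 1) * g (d + 1) \<le> sum f {?l - 1..?r + 1} * sum f {?l + 1..?r - 1}"
        unfolding g0 g2 by (intro mult_mono mono sum_nonneg_f) auto
      also have "\<dots> \<le> (sum f {?l..?r})\<^sup>2"
        \<comment> \<open>The bound \<open>le\<close> gives \<open>d - s \<le> M - d - 2\<close>, so
          the window has distinct ends.\<close>
        using le by (intro window_shrink[OF lc]) simp
      finally show ?thesis using False by (simp add: g1 min_absorb2)
    qed
  qed
  ultimately show ?thesis using g_nonneg by (simp add: log_concave_seq_def)
qed

section \<open>Symmetry of s-binomial coefficients and their differences\<close>

lemma s_binomial_0: "s_binomial s 0 d = (if d = 0 then 1 else 0)"
  by (auto simp: s_binomial_def)

lemma s_binomial_Suc: "s_binomial s (Suc N) d = (\<Sum>j\<le>s. s_binomial s N (d - int j))"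
proof (cases "d < 0")
  case True
  then show ?thesis by (simp add: s_binomial_def)
next
  case False
  then obtain e where "d = int e" by (auto intro: that[of "nat d"])
  then show ?thesis
    by (simp add: s_binomial_def sum_distrib_right coeff_sum coeff_monom_mult)
      (rule sum.cong, auto simp: nat_diff_distrib')
qed

text \<open>The generating polynomial is palindromic: in the recursion, reflection exchanges the
  summands \<open>j\<close> and \<open>s - j\<close>.\<close>

lemma s_binomial_symmetric: "s_binomial s N (int (s * N) - d) = s_binomial s N d"
proof (induction N arbitrary: d)
  case 0
  then show ?case by (simp add: s_binomial_0)
next
  case (Suc N)
  have "s_binomial s (Suc N) (int (s * Suc N) - d)
      = (\<Sum>j\<le>s. s_binomial s N (int (s * N) - (d - int (s - j))))"
    unfolding s_binomial_Suc by (rule sum.cong) (auto simp: of_nat_diff algebra_simps)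
  also have "\<dots> = (\<Sum>j\<le>s. s_binomial s N (d - int (s - j)))"
    by (simp only: Suc.IH)
  also have "\<dots> = s_binomial s (Suc N) d"
    unfolding s_binomial_Suc
    by (rule sum.reindex_bij_witness[of _ "\<lambda>j. s - j" "\<lambda>j. s - j"]) auto
  finally show ?case .
qed

text \<open>These are the coefficients of \<open>(1 - x) * (1 + x + ... + x^s)^N\<close>, an
  antipalindromic polynomial; hence the reflection about \<open>(s * N + 1) / 2\<close>
  below.\<close>

definition s_binomial_diff :: "nat \<Rightarrow> nat \<Rightarrow> int \<Rightarrow> int" where
  "s_binomial_diff s N d = s_binomial s N d - s_binomial s N (d - 1)"

lemma s_binomial_diff_Suc:
  "s_binomial_diff s (Suc N) d = sum (s_binomial_diff s N) {d - int s..d}"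
proof -
  have "s_binomial_diff s (Suc N) d = (\<Sum>j\<le>s. s_binomial_diff s N (d - int j))"
    by (simp add: s_binomial_diff_def s_binomial_Suc sum_subtractf algebra_simps)
  also have "\<dots> = sum (s_binomial_diff s N) {d - int s..d}"
    by (rule sum.reindex_bij_witness[of _ "\<lambda>i. nat (d - i)" "\<lambda>j. d - int j"]) auto
  finally show ?thesis .
qed

lemma s_binomial_diff_antisymmetric:
  "s_binomial_diff s N (int (s * N) + 1 - d) = - s_binomial_diff s N d"
proof -
  have "int (s * N) + 1 - d = int (s * N) - (d - 1)"
    and "int (s * N) + 1 - d - 1 = int (s * N) - d"
    by simp_all
  then show ?thesis
    by (simp only: s_binomial_diff_def s_binomial_symmetric)
qed

text \<open>Reflection preserves the window and flips every sign, so the sum equals its own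
  negative.\<close>

lemma sum_s_binomial_diff_symmetric_window:
  "sum (s_binomial_diff s N) {int (s * N) + 1 - d..d} = 0"
proof -
  have "sum (s_binomial_diff s N) {int (s * N) + 1 - d..d}
      = (\<Sum>i\<in>{int (s * N) + 1 - d..d}. s_binomial_diff s N (int (s * N) + 1 - i))"
    by (rule sum.reindex_bij_witness[of _ "\<lambda>i. int (s * N) + 1 - i" "\<lambda>i. int (s * N) + 1 - i"]) auto
  also have "\<dots> = - sum (s_binomial_diff s N) {int (s * N) + 1 - d..d}"
    by (simp only: s_binomial_diff_antisymmetric sum_negf)
  finally show ?thesis by linarith
qed

section \<open>Multiplicities and the s-Catalan triangle\<close>

text \<open>The cutoff keeps exactly the indices whose highest weight \<open>s * N - 2 * d\<close>
  is nonnegative; past it the differences are the negatives of earlier ones.\<close>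

definition multiplicity_seq :: "nat \<Rightarrow> nat \<Rightarrow> int \<Rightarrow> int" where
  "multiplicity_seq s N d = (if 2 * d \<le> int (s * N) then s_binomial_diff s N d else 0)"

lemma multiplicity_seq_0: "multiplicity_seq s 0 = (\<lambda>d. if d = 0 then 1 else 0)"
  by (rule ext) (simp add: multiplicity_seq_def s_binomial_diff_def s_binomial_0)

text \<open>
  Past the middle index, the part of the window on which the differences are antisymmetric
  cancels; this is the Clebsch-Gordan rule.
\<close>

lemma multiplicity_seq_Suc:
  "multiplicity_seq s (Suc N) =
     (\<lambda>d. if 2 * d \<le> int (s * N) + int s
          then sum (multiplicity_seq s N) {d - int s..min d (int (s * N) - d)} else 0)"
proof
  fix d
  let ?M = "int (s * N)" and ?h = "s_binomial_diff s N"
  have "sum ?h {d - int s..d} = sum ?h {d - int s..min d (?M - d)}"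
    if le: "2 * d \<le> ?M + int s"
  proof (cases "2 * d \<le> ?M")
    case True
    then show ?thesis by (simp add: min_absorb1)
  next
    case False
    then have "{d - int s..d} = {d - int s..?M - d} \<union> {?M + 1 - d..d}"
      using le by auto
    then have "sum ?h {d - int s..d} = sum ?h {d - int s..?M - d} + sum ?h {?M + 1 - d..d}"
      by (simp add: sum.union_disjoint)
    then show ?thesis
      using False by (simp add: sum_s_binomial_diff_symmetric_window min_absorb2 del: of_nat_mult)
  qed
  \<comment> \<open>From \<open>i \<le> d\<close> and \<open>i \<le> ?M - d\<close> follows
    \<open>2 * i \<le> ?M\<close>, so the cutoff never applies inside the window.\<close>
  moreover have "sum ?h {d - int s..min d (?M - d)}
      = sum (multiplicity_seq s N) {d - int s..min d (?M - d)}"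
    by (rule sum.cong) (auto simp: multiplicity_seq_def)
  ultimately show "multiplicity_seq s (Suc N) d =
      (if 2 * d \<le> ?M + int s
       then sum (multiplicity_seq s N) {d - int s..min d (?M - d)} else 0)"
    by (simp add: multiplicity_seq_def s_binomial_diff_Suc algebra_simps)
qed

lemma log_concave_multiplicity_seq: "log_concave_seq (multiplicity_seq s N)"
proof (induction N)
  case 0
  show ?case
    unfolding multiplicity_seq_0 log_concave_seq_def
    by (intro conjI allI impI) (simp_all split: if_splits)
next
  case (Suc N)
  show ?case
    unfolding multiplicity_seq_Suc by (rule log_concave_seq_window_sum[OF Suc]) simp
qed

text \<open>Symmetry about \<open>s * n\<close> turns the descending difference at
  \<open>s * n + k\<close> into the ascending one at \<open>s * n - k\<close>, which lies before the
  cutoff.\<close>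

lemma s_catalan_eq_multiplicity:
  "s_catalan s n k = multiplicity_seq s (2 * n) (int (s * n) - int k)"
proof -
  have "int (s * n + k) = int (s * (2 * n)) - (int (s * n) - int k)"
    and "int (s * n + k + 1) = int (s * (2 * n)) - (int (s * n) - int k - 1)"
    by simp_all
  then have "s_catalan s n k = s_binomial_diff s (2 * n) (int (s * n) - int k)"
    by (simp only: s_catalan_def s_binomial_diff_def s_binomial_symmetric)
  then show ?thesis by (simp add: multiplicity_seq_def)
qed

theorem corollary5p12:
  fixes m n k :: nat
  assumes "m \<ge> 2" and "n \<ge> 1" and "k \<ge> 1"
  shows "(s_catalan (m - 1) n k)\<^sup>2 \<ge>
         s_catalan (m - 1) n (k - 1) * s_catalan (m - 1) n (k + 1)"
proof -
  let ?d = "int ((m - 1) * n) - int k"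
  let ?f = "multiplicity_seq (m - 1) (2 * n)"
  have "?f (?d - 1) * ?f (?d + 1) \<le> (?f ?d)\<^sup>2"
    using log_concave_multiplicity_seq by (rule log_concave_seq_square)
  \<comment> \<open>Increasing \<open>k\<close> lowers the index, so the two neighbours swap;
    \<open>k \<ge> 1\<close> keeps the natural subtraction \<open>k - 1\<close> exact.\<close>
  moreover have "int ((m - 1) * n) - int (k - 1) = ?d + 1"
    and "int ((m - 1) * n) - int (k + 1) = ?d - 1"
    using \<open>k \<ge> 1\<close> by (simp_all add: of_nat_diff)
  ultimately show ?thesis
    unfolding s_catalan_eq_multiplicity by (simp only: mult.commute)
qed

end
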